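(* Let $f\colon (X,\mathcal{E}_X)\to(Y,\mathcal{E}_Y)$ be a map between quasi-coarse spaces. Then the following are equivalent: (a) $f$ is a $\operatorname{Sym}$-coarse equivalence; (b) $f\colon (X,\mathcal{E}_X)\to(Y,\mathcal{E}_Y)$ is large-scale bijective, bornologous and weakly uniformly bounded copreserving; (c) $f\colon (X,\mathcal{E}_X)\to(Y,\mathcal{E}_Y)$ is large-scale bijective, bornologous and uniformly bounded copreserving; (d) $f\colon (X,\mathcal{E}_X)\to(Y,\mathcal{E}_Y)$ is large-scale surjective, bornologous and effectively proper; (e) there exist two subspaces $X'\subseteq X$ and $Y'\subseteq Y$, which are large in $(X,\operatorname{Sym}(\mathcal{E}_X))$ and in $(Y,\operatorname{Sym}(\mathcal{E}_Y))$, respectively, and an asymorphism $f'\colon X'\to Y'$.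
   Context: For $E,F\subseteq X\times X$, $x\in X$, $A\subseteq X$ put $E^{-1}=\{(x,y)\mid (y,x)\in E\}$, $E\circ F=\{(x,z)\mid \exists y\in X:\ (x,y)\in E,\ (y,z)\in F\}$, $E[x]=\{y\mid (x,y)\in E\}$, $E[A]=\bigcup_{a\in A}E[a]$, $\Delta_X=\{(x,x)\mid x\in X\}$. A quasi-coarse structure on $X$ is a family $\mathcal{E}$ of subsets of $X\times X$ closed under subsets and finite unions, with $\Delta_X\in\mathcal{E}$ and $E\circ F\in\mathcal{E}$ for all $E,F\in\mathcal{E}$; $(X,\mathcal{E})$ is then a quasi-coarse space. Put $\mathcal{E}^{-1}=\{E^{-1}\mid E\in\mathcal{E}\}$ and $\operatorname{Sym}(\mathcal{E})=\mathcal{E}\cap\mathcal{E}^{-1}$ (a coarse structure, i.e. a quasi-coarse structure closed under $E\mapsto E^{-1}$). A subspace $X'\subseteq X$ carries the structure $\{E\cap(X'\times X')\mid E\in\mathcal{E}\}$. A subset $A$ of a coarse space $(X,\mathcal{C})$ is large in it if $E[A]=X$ for some $E\in\mathcal{C}$. A map $f\colon(X,\mathcal{E}_X)\to(Y,\mathcal{E}_Y)$ is: - bornologous if $(f\times f)(E)\in\mathcal{E}_Y$ for every $E\in\mathcal{E}_X$; - weakly uniformly bounded copreserving if for every $E\in\mathcal{E}_Y$ there is $F\in\mathcal{E}_X$ with $(f\times f)(F)=E\cap(f(X)\times f(X))$; - uniformly bounded copreserving if for every $E\in\mathcal{E}_Y$ there is $F\in\mathcal{E}_X$ with $E[f(x)]\cap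 f(X)\subseteq f(F[x])$ for every $x\in X$; - effectively proper if $(f\times f)^{-1}(E)\in\mathcal{E}_X$ for every $E\in\mathcal{E}_Y$; - large-scale injective if $R_f=\{(x,y)\in X\times X\mid f(x)=f(y)\}\in\mathcal{E}_X$; - large-scale surjective if $f(X)$ is large in $(Y,\operatorname{Sym}(\mathcal{E}_Y))$; - large-scale bijective if it is large-scale injective and large-scale surjective; - an asymorphism if it is bijective and both $f$ and $f^{-1}$ are bornologous. Two maps $f,g\colon X\to(Y,\mathcal{E}_Y)$ are $\operatorname{Sym}$-close, $f\sim_{\operatorname{Sym}}g$, if $\{(f(x),g(x))\mid x\in X\}\in\operatorname{Sym}(\mathcal{E}_Y)$. A map $g\colon Y\to X$ is a $\operatorname{Sym}$-coarse inverse of $f\colon X\to Y$ if $g\circ f\sim_{\operatorname{Sym}}id_X$ and $f\circ g\sim_{\operatorname{Sym}}id_Y$. The map $f$ is a $\operatorname{Sym}$-coarse equivalence if it is bornologous and has a bornologous $\operatorname{Sym}$-coarse inverse.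
   Formalization: As stated, (e) does not mention f and the equivalence fails (constant f on two discrete points); (e) here asks that f be bornologous and f' be the restriction of f, and (e) as stated is proved equivalent to the existence of some Sym-coarse equivalence from X to Y. *)

theory Defs
  imports Main "HOL-Library.FuncSet"
begin

text \<open>
  A space is an explicit carrier \<open>X\<close> together with a family of relations on \<open>X\<close>; carriers may be
  empty. A map \<open>X \<rightarrow> Y\<close> is a function in \<open>X \<rightarrow> Y\<close> (see \<^theory>\<open>HOL-Library.FuncSet\<close>); all notions
  below depend only on its values on \<open>X\<close>. The operations
  \<open>E\<^sup>-\<^sup>1\<close>, \<open>E \<circ> F\<close>, \<open>E[A]\<close> and \<open>\<Delta>\<^sub>X\<close> are \<^const>\<open>converse\<close>, \<^const>\<open>relcomp\<close> (same order of
  composition), \<^const>\<open>Image\<close> and \<^const>\<open>Id_on\<close>.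
\<close>

definition quasi_coarse_space :: "'a set \<Rightarrow> 'a rel set \<Rightarrow> bool" where
  "quasi_coarse_space X \<E> \<longleftrightarrow>
     \<E> \<subseteq> Pow (X \<times> X) \<and>
     (\<forall>E\<in>\<E>. \<forall>F. F \<subseteq> E \<longrightarrow> F \<in> \<E>) \<and>
     (\<forall>E\<in>\<E>. \<forall>F\<in>\<E>. E \<union> F \<in> \<E>) \<and>
     Id_on X \<in> \<E> \<and>
     (\<forall>E\<in>\<E>. \<forall>F\<in>\<E>. E O F \<in> \<E>)"

definition Sym :: "'a rel set \<Rightarrow> 'a rel set" where
  "Sym \<E> = \<E> \<inter> converse ` \<E>"

definition subspace_structure :: "'a rel set \<Rightarrow> 'a set \<Rightarrow> 'a rel set" where
  "subspace_structure \<E> X' = {E \<inter> (X' \<times> X') | E. E \<in> \<E>}"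

definition large_in :: "'a set \<Rightarrow> 'a rel set \<Rightarrow> 'a set \<Rightarrow> bool" where
  "large_in X \<C> A \<longleftrightarrow> A \<subseteq> X \<and> (\<exists>E\<in>\<C>. E `` A = X)"

definition bornologous :: "'a rel set \<Rightarrow> 'b rel set \<Rightarrow> ('a \<Rightarrow> 'b) \<Rightarrow> bool" where
  "bornologous \<E>X \<E>Y f \<longleftrightarrow> (\<forall>E\<in>\<E>X. map_prod f f ` E \<in> \<E>Y)"

definition weakly_uniformly_bounded_copreserving ::
    "'a set \<Rightarrow> 'a rel set \<Rightarrow> 'b rel set \<Rightarrow> ('a \<Rightarrow> 'b) \<Rightarrow> bool" where
  "weakly_uniformly_bounded_copreserving X \<E>X \<E>Y f \<longleftrightarrow>
     (\<forall>E\<in>\<E>Y. \<exists>F\<in>\<E>X. map_prod f f ` F = E \<inter> (f ` X \<times> f ` X))"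

definition uniformly_bounded_copreserving ::
    "'a set \<Rightarrow> 'a rel set \<Rightarrow> 'b rel set \<Rightarrow> ('a \<Rightarrow> 'b) \<Rightarrow> bool" where
  "uniformly_bounded_copreserving X \<E>X \<E>Y f \<longleftrightarrow>
     (\<forall>E\<in>\<E>Y. \<exists>F\<in>\<E>X. \<forall>x\<in>X. E `` {f x} \<inter> f ` X \<subseteq> f ` (F `` {x}))"

definition effectively_proper ::
    "'a set \<Rightarrow> 'a rel set \<Rightarrow> 'b rel set \<Rightarrow> ('a \<Rightarrow> 'b) \<Rightarrow> bool" where
  "effectively_proper X \<E>X \<E>Y f \<longleftrightarrow>
     (\<forall>E\<in>\<E>Y. {(x, y) \<in> X \<times> X. (f x, f y) \<in> E} \<in> \<E>X)"

definition large_scale_injective :: "'a set \<Rightarrow> 'a rel set \<Rightarrow> ('a \<Rightarrow> 'b) \<Rightarrow> bool" where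
  "large_scale_injective X \<E>X f \<longleftrightarrow> {(x, y) \<in> X \<times> X. f x = f y} \<in> \<E>X"

definition large_scale_surjective ::
    "'a set \<Rightarrow> 'b set \<Rightarrow> 'b rel set \<Rightarrow> ('a \<Rightarrow> 'b) \<Rightarrow> bool" where
  "large_scale_surjective X Y \<E>Y f \<longleftrightarrow> large_in Y (Sym \<E>Y) (f ` X)"

definition large_scale_bijective ::
    "'a set \<Rightarrow> 'a rel set \<Rightarrow> 'b set \<Rightarrow> 'b rel set \<Rightarrow> ('a \<Rightarrow> 'b) \<Rightarrow> bool" where
  "large_scale_bijective X \<E>X Y \<E>Y f \<longleftrightarrow>
     large_scale_injective X \<E>X f \<and> large_scale_surjective X Y \<E>Y f"

definition asymorphism ::
    "'a set \<Rightarrow> 'a rel set \<Rightarrow> 'b set \<Rightarrow> 'b rel set \<Rightarrow> ('a \<Rightarrow> 'b) \<Rightarrow> bool" where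
  "asymorphism X \<E>X Y \<E>Y f \<longleftrightarrow>
     bij_betw f X Y \<and> bornologous \<E>X \<E>Y f \<and> bornologous \<E>Y \<E>X (inv_into X f)"

definition Sym_close :: "'a set \<Rightarrow> 'b rel set \<Rightarrow> ('a \<Rightarrow> 'b) \<Rightarrow> ('a \<Rightarrow> 'b) \<Rightarrow> bool" where
  "Sym_close X \<E>Y f g \<longleftrightarrow> {(f x, g x) | x. x \<in> X} \<in> Sym \<E>Y"

definition Sym_coarse_inverse ::
    "'a set \<Rightarrow> 'a rel set \<Rightarrow> 'b set \<Rightarrow> 'b rel set \<Rightarrow> ('a \<Rightarrow> 'b) \<Rightarrow> ('b \<Rightarrow> 'a) \<Rightarrow> bool" where
  "Sym_coarse_inverse X \<E>X Y \<E>Y f g \<longleftrightarrow>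
     g \<in> Y \<rightarrow> X \<and> Sym_close X \<E>X (g \<circ> f) id \<and> Sym_close Y \<E>Y (f \<circ> g) id"

definition Sym_coarse_equivalence ::
    "'a set \<Rightarrow> 'a rel set \<Rightarrow> 'b set \<Rightarrow> 'b rel set \<Rightarrow> ('a \<Rightarrow> 'b) \<Rightarrow> bool" where
  "Sym_coarse_equivalence X \<E>X Y \<E>Y f \<longleftrightarrow>
     f \<in> X \<rightarrow> Y \<and> bornologous \<E>X \<E>Y f \<and>
     (\<exists>g. Sym_coarse_inverse X \<E>X Y \<E>Y f g \<and> bornologous \<E>Y \<E>X g)"

text \<open>
  Asymorphic large subspaces given by an arbitrary \<open>f'\<close> say nothing about a particular
  \<open>f : X \<rightarrow> Y\<close>: on a two-point set with the structure of all subsets of the diagonal, the identity is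
  an asymorphism, but a constant \<open>f\<close> is not a \<open>Sym\<close>-coarse equivalence. To be compared with
  properties of \<open>f\<close>, the map \<open>f'\<close> has to be the restriction of \<open>f\<close>, and \<open>f\<close> has to be bornologous
  since the restriction does not control \<open>f\<close> off \<open>X'\<close>. The condition without \<open>f\<close> characterises
  the existence of some \<open>Sym\<close>-coarse equivalence \<open>X \<rightarrow> Y\<close>.
\<close>

definition asymorphism_of_large_subspaces ::
    "'a set \<Rightarrow> 'a rel set \<Rightarrow> 'b set \<Rightarrow> 'b rel set \<Rightarrow> 'a set \<Rightarrow> 'b set \<Rightarrow> ('a \<Rightarrow> 'b) \<Rightarrow> bool" where
  "asymorphism_of_large_subspaces X \<E>X Y \<E>Y X' Y' f' \<longleftrightarrow>
     large_in X (Sym \<E>X) X' \<and> large_in Y (Sym \<E>Y) Y' \<and>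
     asymorphism X' (subspace_structure \<E>X X') Y' (subspace_structure \<E>Y Y') f'"

end

theory Submission
  imports Defs
begin

text \<open>
  Everything is compared with (d). A choice \<open>g y\<close> of a point with \<open>f (g y)\<close> close to \<open>y\<close> is a coarse
  inverse, and effective properness turns closeness of images into closeness of points. Both
  copreservation properties give control up to the fibres of \<open>f\<close>, and large-scale injectivity
  controls the fibres. For (e), one restricts \<open>f\<close> to a section of its fibres; conversely, a retraction
  onto a large subspace that moves points by a bounded amount transfers all estimates to the whole
  space.
\<close>

section \<open>Quasi-coarse structures, subspaces and retractions onto large subsets\<close>

lemma quasi_coarse_spaceD:
  assumes "quasi_coarse_space X \<E>"
  shows quasi_coarse_carrier: "E \<in> \<E> \<Longrightarrow> E \<subseteq> X \<times> X"
    and quasi_coarse_subset: "E \<in> \<E> \<Longrightarrow> F \<subseteq> E \<Longrightarrow> F \<in> \<E>"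
    and quasi_coarse_Un: "E \<in> \<E> \<Longrightarrow> F \<in> \<E> \<Longrightarrow> E \<union> F \<in> \<E>"
    and quasi_coarse_Id_on: "Id_on X \<in> \<E>"
    and quasi_coarse_relcomp: "E \<in> \<E> \<Longrightarrow> F \<in> \<E> \<Longrightarrow> E O F \<in> \<E>"
proof -
  have *: "\<E> \<subseteq> Pow (X \<times> X)" "\<forall>E\<in>\<E>. \<forall>F. F \<subseteq> E \<longrightarrow> F \<in> \<E>"
    "\<forall>E\<in>\<E>. \<forall>F\<in>\<E>. E \<union> F \<in> \<E>" "Id_on X \<in> \<E>" "\<forall>E\<in>\<E>. \<forall>F\<in>\<E>. E O F \<in> \<E>"
    using assms unfolding quasi_coarse_space_def by simp_all
  show "E \<in> \<E> \<Longrightarrow> E \<subseteq> X \<times> X" using *(1) by blast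
  show "E \<in> \<E> \<Longrightarrow> F \<subseteq> E \<Longrightarrow> F \<in> \<E>" using *(2) by simp
  show "E \<in> \<E> \<Longrightarrow> F \<in> \<E> \<Longrightarrow> E \<union> F \<in> \<E>" using *(3) by simp
  show "Id_on X \<in> \<E>" by (rule *(4))
  show "E \<in> \<E> \<Longrightarrow> F \<in> \<E> \<Longrightarrow> E O F \<in> \<E>" using *(5) by simp
qed

lemma Sym_iff: "E \<in> Sym \<E> \<longleftrightarrow> E \<in> \<E> \<and> E\<inverse> \<in> \<E>"
  unfolding Sym_def by (metis IntE IntI converse_converse imageE imageI)

lemma bornologousD: "bornologous \<E>X \<E>Y f \<Longrightarrow> E \<in> \<E>X \<Longrightarrow> map_prod f f ` E \<in> \<E>Y"
  unfolding bornologous_def by blast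

lemma effectively_properD:
  "effectively_proper X \<E>X \<E>Y f \<Longrightarrow> E \<in> \<E>Y \<Longrightarrow> {(x, y) \<in> X \<times> X. (f x, f y) \<in> E} \<in> \<E>X"
  unfolding effectively_proper_def by blast

lemma subspace_structure_subset:
  assumes "quasi_coarse_space X \<E>"
  shows "subspace_structure \<E> X' \<subseteq> \<E>"
  unfolding subspace_structure_def using quasi_coarse_subset[OF assms] by blast

lemma subspace_structureI: "E \<in> \<E> \<Longrightarrow> E \<subseteq> X' \<times> X' \<Longrightarrow> E \<in> subspace_structure \<E> X'"
  unfolding subspace_structure_def by blast

text \<open>Largeness provides, for each point outside \<open>A\<close>, some point of
  \<open>A\<close> related to it, and \<open>p\<close> chooses one. Both \<open>N\<close> and its
  converse are recorded because a quasi-coarse structure need not contain converses, while later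
  estimates move points in both directions. That \<open>p\<close> fixes \<open>A\<close> is what
  makes composition with \<open>p\<close> an extension of a map on \<open>A\<close>.\<close>

lemma large_in_retraction:
  assumes q: "quasi_coarse_space X \<E>" and "large_in X (Sym \<E>) A"
  obtains p N where "N \<in> \<E>" "N\<inverse> \<in> \<E>" "\<And>x. x \<in> X \<Longrightarrow> p x \<in> A" "\<And>x. x \<in> X \<Longrightarrow> (p x, x) \<in> N"
    "\<And>x. x \<in> A \<Longrightarrow> p x = x"
proof -
  obtain M where M: "M \<in> \<E>" "M\<inverse> \<in> \<E>" "M `` A = X" and A: "A \<subseteq> X"
    using assms(2) unfolding large_in_def by (auto simp: Sym_iff)
  define p where "p x = (if x \<in> A then x else SOME a. a \<in> A \<and> (a, x) \<in> M)" for x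
  \<comment> \<open>The diagonal is added since \<open>M\<close> may fail to relate a point of
    \<open>A\<close> to itself.\<close>
  have "p x \<in> A \<and> (p x, x) \<in> M \<union> Id_on X" if "x \<in> X" for x
  proof (cases "x \<in> A")
    case True
    then show ?thesis using that by (auto simp: p_def)
  next
    case False
    have "\<exists>a. a \<in> A \<and> (a, x) \<in> M" using M(3) that by blast
    from someI_ex[OF this] show ?thesis using False by (simp add: p_def)
  qed
  moreover have "M \<union> Id_on X \<in> \<E>" "(M \<union> Id_on X)\<inverse> \<in> \<E>"
    using M q by (auto simp: converse_Un intro!: quasi_coarse_Un quasi_coarse_Id_on)
  ultimately show thesis using that[of "M \<union> Id_on X" p] by (simp add: p_def)
qed

section \<open>Coarse inverses and effectively proper maps: (a) and (d)\<close>

lemma Sym_coarse_equivalence_imp_surjective_proper: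
  assumes qX: "quasi_coarse_space X \<E>X" and "Sym_coarse_equivalence X \<E>X Y \<E>Y f"
  shows "large_scale_surjective X Y \<E>Y f" "effectively_proper X \<E>X \<E>Y f"
proof -
  obtain g where fX: "f \<in> X \<rightarrow> Y" and gY: "g \<in> Y \<rightarrow> X" and gb: "bornologous \<E>Y \<E>X g"
    and gf: "Sym_close X \<E>X (g \<circ> f) id" and fg: "Sym_close Y \<E>Y (f \<circ> g) id"
    using assms(2) unfolding Sym_coarse_equivalence_def Sym_coarse_inverse_def by blast
  define M where "M = {((f \<circ> g) y, id y) | y. y \<in> Y}"
  have "M \<in> Sym \<E>Y" using fg unfolding M_def Sym_close_def .
  moreover have "M `` (f ` X) = Y"
    unfolding M_def using gY by fastforce
  moreover have "f ` X \<subseteq> Y" using fX by blast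
  ultimately show "large_scale_surjective X Y \<E>Y f"
    unfolding large_scale_surjective_def large_in_def by blast
  define N where "N = {((g \<circ> f) x, id x) | x. x \<in> X}"
  have N: "N \<in> \<E>X" "N\<inverse> \<in> \<E>X" using gf unfolding N_def Sym_close_def Sym_iff by blast+
  show "effectively_proper X \<E>X \<E>Y f"
    unfolding effectively_proper_def
  proof
    fix E assume "E \<in> \<E>Y"
    \<comment> \<open>The path from \<open>x\<close> to \<open>y\<close> runs through
      \<open>g (f x)\<close> and \<open>g (f y)\<close>: the outer steps are bounded by closeness to
      the identity, the middle one because \<open>g\<close> is bornologous.\<close>
    then have "N\<inverse> O map_prod g g ` E O N \<in> \<E>X"
      using N qX gb by (intro quasi_coarse_relcomp bornologousD)
    moreover have "{(x, y) \<in> X \<times> X. (f x, f y) \<in> E} \<subseteq> N\<inverse> O map_prod g g ` E O N"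
    proof clarify
      fix x y assume *: "x \<in> X" "y \<in> X" "(f x, f y) \<in> E"
      have "(x, g (f x)) \<in> N\<inverse>" "(g (f y), y) \<in> N" using * by (auto simp: N_def)
      moreover have "(g (f x), g (f y)) \<in> map_prod g g ` E" using * by force
      ultimately show "(x, y) \<in> N\<inverse> O map_prod g g ` E O N" by (intro relcompI)
    qed
    ultimately show "{(x, y) \<in> X \<times> X. (f x, f y) \<in> E} \<in> \<E>X"
      by (rule quasi_coarse_subset[OF qX])
  qed
qed

text \<open>The inverse sends \<open>y\<close> to a preimage of a nearby point of the image of
  \<open>f\<close>. Both remaining demands on \<open>g\<close> in \<open>X\<close>, closeness of
  \<open>g \<circ> f\<close> to the identity and being bornologous, become bounds in
  \<open>Y\<close> after applying \<open>f\<close>, and effective properness pulls them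
  back.\<close>

lemma Sym_coarse_equivalenceI:
  assumes qX: "quasi_coarse_space X \<E>X" and qY: "quasi_coarse_space Y \<E>Y" and fX: "f \<in> X \<rightarrow> Y"
    and "large_scale_surjective X Y \<E>Y f" and bo: "bornologous \<E>X \<E>Y f"
    and ep: "effectively_proper X \<E>X \<E>Y f"
  shows "Sym_coarse_equivalence X \<E>X Y \<E>Y f"
proof -
  obtain p M where M: "M \<in> \<E>Y" "M\<inverse> \<in> \<E>Y" and pI: "\<And>y. y \<in> Y \<Longrightarrow> p y \<in> f ` X"
    and pM: "\<And>y. y \<in> Y \<Longrightarrow> (p y, y) \<in> M"
    using large_in_retraction[OF qY] assms(4) unfolding large_scale_surjective_def by metis
  define g where "g y = inv_into X f (p y)" for y
  have gX: "g y \<in> X" and fg: "(f (g y), y) \<in> M" if "y \<in> Y" for y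
    using pI[OF that] pM[OF that] by (auto simp: g_def inv_into_into f_inv_into_f)
  have "Sym_close Y \<E>Y (f \<circ> g) id"
  proof -
    have "{((f \<circ> g) y, id y) | y. y \<in> Y} \<subseteq> M" using fg by auto
    moreover from this have "{((f \<circ> g) y, id y) | y. y \<in> Y}\<inverse> \<subseteq> M\<inverse>" by blast
    ultimately show ?thesis
      unfolding Sym_close_def Sym_iff using M quasi_coarse_subset[OF qY] by meson
  qed
  moreover have "Sym_close X \<E>X (g \<circ> f) id"
  proof -
    let ?G = "{((g \<circ> f) x, id x) | x. x \<in> X}"
    \<comment> \<open>This is \<open>fg\<close> at the point \<open>f x\<close>. The two
      orientations are pulled back separately, from \<open>M\<close> and from its converse.\<close>
    have "?G \<subseteq> {(x, y) \<in> X \<times> X. (f x, f y) \<in> M}"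
      "?G\<inverse> \<subseteq> {(x, y) \<in> X \<times> X. (f x, f y) \<in> M\<inverse>}"
      using fg gX fX by auto
    then show ?thesis
      unfolding Sym_close_def Sym_iff
      using M effectively_properD[OF ep] quasi_coarse_subset[OF qX] by meson
  qed
  moreover have "bornologous \<E>Y \<E>X g"
    unfolding bornologous_def
  proof
    fix E assume E: "E \<in> \<E>Y"
    \<comment> \<open>The path from \<open>f (g y)\<close> to \<open>f (g z)\<close> passes through
      \<open>y\<close> and \<open>z\<close>.\<close>
    have "map_prod g g ` E \<subseteq> {(x, y) \<in> X \<times> X. (f x, f y) \<in> M O E O M\<inverse>}"
    proof clarsimp
      fix y z assume yz: "(y, z) \<in> E"
      then have "y \<in> Y" "z \<in> Y" using quasi_coarse_carrier[OF qY E] by auto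
      then show "g y \<in> X \<and> g z \<in> X \<and> (f (g y), f (g z)) \<in> M O E O M\<inverse>"
        using yz fg gX by blast
    qed
    moreover have "M O E O M\<inverse> \<in> \<E>Y" using E M qY by (intro quasi_coarse_relcomp)
    ultimately show "map_prod g g ` E \<in> \<E>X"
      using effectively_properD[OF ep] quasi_coarse_subset[OF qX] by meson
  qed
  ultimately show ?thesis
    unfolding Sym_coarse_equivalence_def Sym_coarse_inverse_def using fX bo gX by blast
qed

section \<open>Copreservation and control of fibres: (b) and (c) against (d)\<close>

lemma effectively_proper_imp_large_scale_injective:
  assumes "quasi_coarse_space Y \<E>Y" and "f \<in> X \<rightarrow> Y" and "effectively_proper X \<E>X \<E>Y f"
  shows "large_scale_injective X \<E>X f"
proof -
  \<comment> \<open>The fibre relation is the preimage of the diagonal of \<open>Y\<close>, a member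
    of \<open>\<E>Y\<close>.\<close>
  have "{(x, y) \<in> X \<times> X. f x = f y} = {(x, y) \<in> X \<times> X. (f x, f y) \<in> Id_on Y}"
    using assms(2) by auto
  then show ?thesis
    unfolding large_scale_injective_def
    using effectively_properD[OF assms(3) quasi_coarse_Id_on[OF assms(1)]] by simp
qed

lemma effectively_proper_imp_weakly_copreserving:
  assumes "effectively_proper X \<E>X \<E>Y f"
  shows "weakly_uniformly_bounded_copreserving X \<E>X \<E>Y f"
  unfolding weakly_uniformly_bounded_copreserving_def
proof
  fix E assume "E \<in> \<E>Y"
  moreover have "map_prod f f ` {(x, y) \<in> X \<times> X. (f x, f y) \<in> E} = E \<inter> (f ` X \<times> f ` X)"
    by force
  ultimately show "\<exists>F\<in>\<E>X. map_prod f f ` F = E \<inter> (f ` X \<times> f ` X)"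
    using effectively_properD[OF assms] by blast
qed

lemma effectively_proper_imp_copreserving:
  assumes "effectively_proper X \<E>X \<E>Y f"
  shows "uniformly_bounded_copreserving X \<E>X \<E>Y f"
  unfolding uniformly_bounded_copreserving_def
proof
  fix E assume "E \<in> \<E>Y"
  moreover have "\<forall>x\<in>X. E `` {f x} \<inter> f ` X \<subseteq> f ` ({(x, y) \<in> X \<times> X. (f x, f y) \<in> E} `` {x})"
    by auto
  ultimately show "\<exists>F\<in>\<E>X. \<forall>x\<in>X. E `` {f x} \<inter> f ` X \<subseteq> f ` (F `` {x})"
    using effectively_properD[OF assms] by blast
qed

text \<open>The relation \<open>F\<close> reproduces the pair \<open>(f x, f y)\<close> only through
  some \<open>(x', y')\<close> with the same values. The fibre relation \<open>?R\<close> on either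
  side of \<open>F\<close> corrects both endpoints, and large-scale injectivity makes it
  bounded.\<close>

lemma weakly_copreserving_imp_effectively_proper:
  assumes qX: "quasi_coarse_space X \<E>X" and "large_scale_injective X \<E>X f"
    and wc: "weakly_uniformly_bounded_copreserving X \<E>X \<E>Y f"
  shows "effectively_proper X \<E>X \<E>Y f"
  unfolding effectively_proper_def
proof
  fix E assume "E \<in> \<E>Y"
  then obtain F where F: "F \<in> \<E>X" "map_prod f f ` F = E \<inter> (f ` X \<times> f ` X)"
    using wc unfolding weakly_uniformly_bounded_copreserving_def by blast
  let ?R = "{(x, y) \<in> X \<times> X. f x = f y}"
  have "?R O F O ?R \<in> \<E>X"
    using assms(2) F(1) qX unfolding large_scale_injective_def by (intro quasi_coarse_relcomp)
  moreover have "{(x, y) \<in> X \<times> X. (f x, f y) \<in> E} \<subseteq> ?R O F O ?R"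
  proof clarify
    fix x y assume *: "x \<in> X" "y \<in> X" "(f x, f y) \<in> E"
    then have "(f x, f y) \<in> map_prod f f ` F" unfolding F(2) by blast
    then obtain x' y' where "(x', y') \<in> F" "f x = f x'" "f y = f y'" by auto
    moreover from this have "(x, x') \<in> ?R" "(y', y) \<in> ?R"
      using quasi_coarse_carrier[OF qX F(1)] * by auto
    ultimately show "(x, y) \<in> ?R O F O ?R" by blast
  qed
  ultimately show "{(x, y) \<in> X \<times> X. (f x, f y) \<in> E} \<in> \<E>X"
    by (rule quasi_coarse_subset[OF qX])
qed

text \<open>Here \<open>F\<close> starts at the given \<open>x\<close> itself, so only the endpoint
  has to be moved along its fibre and a single factor \<open>?R\<close> suffices.\<close>

lemma copreserving_imp_effectively_proper:
  assumes qX: "quasi_coarse_space X \<E>X" and "large_scale_injective X \<E>X f"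
    and uc: "uniformly_bounded_copreserving X \<E>X \<E>Y f"
  shows "effectively_proper X \<E>X \<E>Y f"
  unfolding effectively_proper_def
proof
  fix E assume "E \<in> \<E>Y"
  then obtain F where F: "F \<in> \<E>X" "\<forall>x\<in>X. E `` {f x} \<inter> f ` X \<subseteq> f ` (F `` {x})"
    using uc unfolding uniformly_bounded_copreserving_def by blast
  let ?R = "{(x, y) \<in> X \<times> X. f x = f y}"
  have "F O ?R \<in> \<E>X"
    using assms(2) F(1) qX unfolding large_scale_injective_def by (intro quasi_coarse_relcomp)
  moreover have "{(x, y) \<in> X \<times> X. (f x, f y) \<in> E} \<subseteq> F O ?R"
  proof clarify
    fix x y assume *: "x \<in> X" "y \<in> X" "(f x, f y) \<in> E"
    then obtain y' where "(x, y') \<in> F" "f y = f y'" using F(2) by blast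
    moreover from this have "(y', y) \<in> ?R"
      using quasi_coarse_carrier[OF qX F(1)] * by auto
    ultimately show "(x, y) \<in> F O ?R" by blast
  qed
  ultimately show "{(x, y) \<in> X \<times> X. (f x, f y) \<in> E} \<in> \<E>X"
    by (rule quasi_coarse_subset[OF qX])
qed

section \<open>Asymorphic large subspaces: (d) and (e)\<close>

lemma section_asymorphism:
  assumes qX: "quasi_coarse_space X \<E>X" and qY: "quasi_coarse_space Y \<E>Y" and fX: "f \<in> X \<rightarrow> Y"
    and ls: "large_scale_surjective X Y \<E>Y f" and bo: "bornologous \<E>X \<E>Y f"
    and ep: "effectively_proper X \<E>X \<E>Y f"
  shows "asymorphism_of_large_subspaces X \<E>X Y \<E>Y (inv_into X f ` f ` X) (f ` X) f"
proof -
  let ?S = "inv_into X f ` f ` X"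
  have SX: "?S \<subseteq> X" by (auto intro: inv_into_into)
  have bij: "bij_betw f ?S (f ` X)"
    by (rule bij_betw_byWitness[where f' = "inv_into X f"]) (auto simp: f_inv_into_f inv_into_into)
  have "large_in X (Sym \<E>X) ?S"
  proof -
    let ?R = "{(x, y) \<in> X \<times> X. f x = f y}"
    have R: "?R \<in> \<E>X"
      using effectively_proper_imp_large_scale_injective[OF qY fX ep]
      unfolding large_scale_injective_def .
    \<comment> \<open>Being symmetric, the bounded fibre relation lies in \<open>Sym \<E>X\<close>.
      It joins each point to the representative of its fibre, so the section is large.\<close>
    have "?R\<inverse> = ?R" by auto
    then have "?R \<in> Sym \<E>X" unfolding Sym_iff by (simp only: R)
    moreover have "?R `` ?S = X"
    proof
      show "X \<subseteq> ?R `` ?S"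
      proof
        fix x assume "x \<in> X"
        then have "(inv_into X f (f x), x) \<in> ?R" by (simp add: inv_into_into f_inv_into_f)
        then show "x \<in> ?R `` ?S" using \<open>x \<in> X\<close> by blast
      qed
    qed auto
    ultimately show ?thesis unfolding large_in_def using SX by (intro conjI bexI)
  qed
  moreover have "bornologous (subspace_structure \<E>X ?S) (subspace_structure \<E>Y (f ` X)) f"
    unfolding bornologous_def
  proof
    fix E assume E: "E \<in> subspace_structure \<E>X ?S"
    then have "map_prod f f ` E \<in> \<E>Y"
      by (intro bornologousD[OF bo] subsetD[OF subspace_structure_subset[OF qX]])
    moreover have "E \<subseteq> X \<times> X" using E SX unfolding subspace_structure_def by blast
    ultimately show "map_prod f f ` E \<in> subspace_structure \<E>Y (f ` X)"
      by (intro subspace_structureI) auto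
  qed
  moreover have "bornologous (subspace_structure \<E>Y (f ` X)) (subspace_structure \<E>X ?S) (inv_into ?S f)"
    unfolding bornologous_def
  proof
    fix E assume E: "E \<in> subspace_structure \<E>Y (f ` X)"
    then have EY: "E \<in> \<E>Y" and EX: "E \<subseteq> f ` X \<times> f ` X"
      using subspace_structure_subset[OF qY] unfolding subspace_structure_def by blast+
    have i: "inv_into ?S f y \<in> ?S" "f (inv_into ?S f y) = y" if "y \<in> f ` X" for y
    proof -
      have "y \<in> f ` ?S" using bij that unfolding bij_betw_def by simp
      then show "inv_into ?S f y \<in> ?S" "f (inv_into ?S f y) = y"
        by (rule inv_into_into, rule f_inv_into_f)
    qed
    \<comment> \<open>Applying \<open>f\<close> to the image of \<open>E\<close> under the inverse
      gives back \<open>E\<close>, so this image lies in the preimage of \<open>E\<close>, which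
      effective properness bounds.\<close>
    have "map_prod (inv_into ?S f) (inv_into ?S f) ` E \<subseteq> {(x, y) \<in> X \<times> X. (f x, f y) \<in> E}"
    proof (rule image_subsetI)
      fix q assume "q \<in> E"
      then obtain x y where q: "q = (x, y)" "(x, y) \<in> E" by (cases q) blast
      then have xy: "x \<in> f ` X" "y \<in> f ` X" using EX by blast+
      have "inv_into ?S f x \<in> X" "inv_into ?S f y \<in> X"
        using i(1)[OF xy(1)] i(1)[OF xy(2)] SX by (simp_all only: subsetD)
      then show "map_prod (inv_into ?S f) (inv_into ?S f) q \<in> {(x, y) \<in> X \<times> X. (f x, f y) \<in> E}"
        using q i(2)[OF xy(1)] i(2)[OF xy(2)] by simp
    qed
    then have "map_prod (inv_into ?S f) (inv_into ?S f) ` E \<in> \<E>X"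
      by (rule quasi_coarse_subset[OF qX effectively_properD[OF ep EY]])
    moreover have "map_prod (inv_into ?S f) (inv_into ?S f) ` E \<subseteq> ?S \<times> ?S"
    proof clarify
      fix x y assume "(x, y) \<in> E"
      then have "x \<in> f ` X" "y \<in> f ` X" using EX by blast+
      then show "inv_into ?S f x \<in> ?S \<and> inv_into ?S f y \<in> ?S" by (intro conjI i(1))
    qed
    ultimately show "map_prod (inv_into ?S f) (inv_into ?S f) ` E \<in> subspace_structure \<E>X ?S"
      by (rule subspace_structureI)
  qed
  ultimately show ?thesis
    unfolding asymorphism_of_large_subspaces_def asymorphism_def
    using ls bij unfolding large_scale_surjective_def by (intro conjI)
qed

lemma asymorphism_of_large_subspaces_imp_surjective_proper:
  assumes qX: "quasi_coarse_space X \<E>X" and qY: "quasi_coarse_space Y \<E>Y" and fX: "f \<in> X \<rightarrow> Y"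
    and bo: "bornologous \<E>X \<E>Y f"
    and as: "asymorphism_of_large_subspaces X \<E>X Y \<E>Y X' Y' f'" and ff: "\<forall>x\<in>X'. f' x = f x"
  shows "large_scale_surjective X Y \<E>Y f" "effectively_proper X \<E>X \<E>Y f"
proof -
  have lX: "large_in X (Sym \<E>X) X'" and lY: "large_in Y (Sym \<E>Y) Y'"
    and bij: "bij_betw f' X' Y'"
    and ib: "bornologous (subspace_structure \<E>Y Y') (subspace_structure \<E>X X') (inv_into X' f')"
    using as unfolding asymorphism_of_large_subspaces_def asymorphism_def by blast+
  have X': "X' \<subseteq> X" using lX unfolding large_in_def by blast
  have fX': "f ` X' = Y'" using bij ff unfolding bij_betw_def by auto
  obtain M where M: "M \<in> Sym \<E>Y" "M `` Y' = Y" using lY unfolding large_in_def by blast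
  have "M `` (f ` X) = Y"
  proof
    show "M `` (f ` X) \<subseteq> Y"
      using M(1) quasi_coarse_carrier[OF qY] unfolding Sym_iff by blast
    show "Y \<subseteq> M `` (f ` X)" using M(2) fX' X' by blast
  qed
  then show "large_scale_surjective X Y \<E>Y f"
    unfolding large_scale_surjective_def large_in_def using M(1) fX by blast
  obtain p N where N: "N \<in> \<E>X" "N\<inverse> \<in> \<E>X" and pX: "\<And>x. x \<in> X \<Longrightarrow> p x \<in> X'"
    and pN: "\<And>x. x \<in> X \<Longrightarrow> (p x, x) \<in> N"
    using large_in_retraction[OF qX lX] by metis
  show "effectively_proper X \<E>X \<E>Y f"
    unfolding effectively_proper_def
  proof
    fix E assume "E \<in> \<E>Y"
    \<comment> \<open>This contains \<open>(f (p x), f (p y))\<close> whenever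
      \<open>(f x, f y) \<in> E\<close>. The restriction to \<open>Y'\<close> puts it in the domain
      of the inverse, so that its image \<open>K\<close> contains \<open>(p x, p y)\<close>.\<close>
    let ?G = "(map_prod f f ` N O E O map_prod f f ` N\<inverse>) \<inter> Y' \<times> Y'"
    define K where "K = map_prod (inv_into X' f') (inv_into X' f') ` ?G"
    have "map_prod f f ` N O E O map_prod f f ` N\<inverse> \<in> \<E>Y"
      using N qY bo \<open>E \<in> \<E>Y\<close> by (intro quasi_coarse_relcomp bornologousD)
    then have "?G \<in> subspace_structure \<E>Y Y'" unfolding subspace_structure_def by blast
    then have "K \<in> \<E>X"
      unfolding K_def using bornologousD[OF ib] subspace_structure_subset[OF qX] by blast
    then have "N\<inverse> O K O N \<in> \<E>X" using N qX by (intro quasi_coarse_relcomp)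
    moreover have "{(x, y) \<in> X \<times> X. (f x, f y) \<in> E} \<subseteq> N\<inverse> O K O N"
    proof clarify
      fix x y assume *: "x \<in> X" "y \<in> X" "(f x, f y) \<in> E"
      have "(f (p x), f x) \<in> map_prod f f ` N" "(f y, f (p y)) \<in> map_prod f f ` N\<inverse>"
        using pN * by force+
      moreover have "f (p x) \<in> Y'" "f (p y) \<in> Y'" using fX' pX * by blast+
      ultimately have "(f (p x), f (p y)) \<in> ?G" using *(3) by (intro IntI relcompI SigmaI)
      then have "(inv_into X' f' (f (p x)), inv_into X' f' (f (p y))) \<in> K"
        unfolding K_def by force
      moreover have "inv_into X' f' (f (p z)) = p z" if "z \<in> X" for z
        using pX[OF that] ff bij unfolding bij_betw_def by (metis inv_into_f_f)
      ultimately have "(p x, p y) \<in> K" using * by simp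
      then show "(x, y) \<in> N\<inverse> O K O N" using pN * by blast
    qed
    ultimately show "{(x, y) \<in> X \<times> X. (f x, f y) \<in> E} \<in> \<E>X"
      by (rule quasi_coarse_subset[OF qX])
  qed
qed

text \<open>The extension is \<open>f' \<circ> p\<close> for a retraction \<open>p\<close> onto
  \<open>X'\<close>. Moving points by a bounded amount keeps \<open>p\<close> bornologous, and
  \<open>p\<close> fixes \<open>X'\<close>. Thus an asymorphism given without a map on
  \<open>X\<close> still yields one to which the criterion for restrictions applies.\<close>

lemma bornologous_extension:
  assumes qX: "quasi_coarse_space X \<E>X" and qY: "quasi_coarse_space Y \<E>Y"
    and as: "asymorphism_of_large_subspaces X \<E>X Y \<E>Y X' Y' f'"
  obtains h where "h \<in> X \<rightarrow> Y" "bornologous \<E>X \<E>Y h" "\<forall>x\<in>X'. f' x = h x"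
proof -
  have lX: "large_in X (Sym \<E>X) X'" and lY: "large_in Y (Sym \<E>Y) Y'"
    and bij: "bij_betw f' X' Y'"
    and fb: "bornologous (subspace_structure \<E>X X') (subspace_structure \<E>Y Y') f'"
    using as unfolding asymorphism_of_large_subspaces_def asymorphism_def by blast+
  obtain p N where N: "N \<in> \<E>X" "N\<inverse> \<in> \<E>X" and pX: "\<And>x. x \<in> X \<Longrightarrow> p x \<in> X'"
    and pN: "\<And>x. x \<in> X \<Longrightarrow> (p x, x) \<in> N" and pid: "\<And>x. x \<in> X' \<Longrightarrow> p x = x"
    using large_in_retraction[OF qX lX] by metis
  have "f' \<circ> p \<in> X \<rightarrow> Y"
    using pX bij lY unfolding bij_betw_def large_in_def by auto
  moreover have "bornologous \<E>X \<E>Y (f' \<circ> p)"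
    unfolding bornologous_def
  proof
    fix E assume E: "E \<in> \<E>X"
    have "map_prod p p ` E \<subseteq> N O E O N\<inverse> \<and> map_prod p p ` E \<subseteq> X' \<times> X'"
    proof -
      have "(p x, p y) \<in> N O E O N\<inverse>" "p x \<in> X' \<and> p y \<in> X'" if "(x, y) \<in> E" for x y
      proof -
        have "x \<in> X" "y \<in> X" using that quasi_coarse_carrier[OF qX E] by auto
        then show "(p x, p y) \<in> N O E O N\<inverse>" "p x \<in> X' \<and> p y \<in> X'" using that pX pN by blast+
      qed
      then show ?thesis by auto
    qed
    moreover have "N O E O N\<inverse> \<in> \<E>X" using N E qX by (intro quasi_coarse_relcomp)
    ultimately have "map_prod p p ` E \<in> subspace_structure \<E>X X'"
      by (elim conjE) (rule subspace_structureI[OF quasi_coarse_subset[OF qX]])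
    then have "map_prod f' f' ` map_prod p p ` E \<in> \<E>Y"
      by (rule subsetD[OF subspace_structure_subset[OF qY] bornologousD[OF fb]])
    then show "map_prod (f' \<circ> p) (f' \<circ> p) ` E \<in> \<E>Y"
      by (simp add: image_comp map_prod_compose)
  qed
  ultimately show thesis using that[of "f' \<circ> p"] pid by simp
qed

theorem theorem4p4:
  fixes X :: "'a set" and \<E>X :: "'a rel set"
    and Y :: "'b set" and \<E>Y :: "'b rel set"
    and f :: "'a \<Rightarrow> 'b"
  assumes "quasi_coarse_space X \<E>X"
    and "quasi_coarse_space Y \<E>Y"
    and "f \<in> X \<rightarrow> Y"
  defines "a \<equiv> Sym_coarse_equivalence X \<E>X Y \<E>Y f"
    and "b \<equiv> large_scale_bijective X \<E>X Y \<E>Y f \<and> bornologous \<E>X \<E>Y f \<and>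
               weakly_uniformly_bounded_copreserving X \<E>X \<E>Y f"
    and "c \<equiv> large_scale_bijective X \<E>X Y \<E>Y f \<and> bornologous \<E>X \<E>Y f \<and>
               uniformly_bounded_copreserving X \<E>X \<E>Y f"
    and "d \<equiv> large_scale_surjective X Y \<E>Y f \<and> bornologous \<E>X \<E>Y f \<and>
               effectively_proper X \<E>X \<E>Y f"
    and "e \<equiv> bornologous \<E>X \<E>Y f \<and>
               (\<exists>X' Y' f'. asymorphism_of_large_subspaces X \<E>X Y \<E>Y X' Y' f' \<and>
                  (\<forall>x\<in>X'. f' x = f x))"
    and "e_spaces \<equiv> \<exists>X' Y' f'. asymorphism_of_large_subspaces X \<E>X Y \<E>Y X' Y' f'"
  shows "(a \<longleftrightarrow> b) \<and> (b \<longleftrightarrow> c) \<and> (c \<longleftrightarrow> d) \<and> (d \<longleftrightarrow> e) \<and>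
         ((\<exists>h. Sym_coarse_equivalence X \<E>X Y \<E>Y h) \<longleftrightarrow> e_spaces)"
proof -
  \<comment> \<open>This and \<open>de\<close> are proved for an arbitrary \<open>h\<close>, because
    the existence statement about the spaces concerns maps other than \<open>f\<close>.\<close>
  have ad: "Sym_coarse_equivalence X \<E>X Y \<E>Y h \<longleftrightarrow>
      large_scale_surjective X Y \<E>Y h \<and> bornologous \<E>X \<E>Y h \<and> effectively_proper X \<E>X \<E>Y h"
    if "h \<in> X \<rightarrow> Y" for h
    using Sym_coarse_equivalence_imp_surjective_proper[OF assms(1)]
      Sym_coarse_equivalenceI[OF assms(1,2) that]
    by (meson Sym_coarse_equivalence_def)
  have bd: "b \<longleftrightarrow> d"
    unfolding b_def d_def large_scale_bijective_def
    using effectively_proper_imp_large_scale_injective[OF assms(2,3)]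
      effectively_proper_imp_weakly_copreserving weakly_copreserving_imp_effectively_proper[OF assms(1)]
    by metis
  have cd: "c \<longleftrightarrow> d"
    unfolding c_def d_def large_scale_bijective_def
    using effectively_proper_imp_large_scale_injective[OF assms(2,3)]
      effectively_proper_imp_copreserving copreserving_imp_effectively_proper[OF assms(1)]
    by metis
  have de: "large_scale_surjective X Y \<E>Y h \<and> bornologous \<E>X \<E>Y h \<and> effectively_proper X \<E>X \<E>Y h
      \<longleftrightarrow> bornologous \<E>X \<E>Y h \<and>
        (\<exists>X' Y' f'. asymorphism_of_large_subspaces X \<E>X Y \<E>Y X' Y' f' \<and> (\<forall>x\<in>X'. f' x = h x))"
    if "h \<in> X \<rightarrow> Y" for h
    using section_asymorphism[OF assms(1,2) that]
      asymorphism_of_large_subspaces_imp_surjective_proper[OF assms(1,2) that] by blast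
  have "(\<exists>h. Sym_coarse_equivalence X \<E>X Y \<E>Y h) \<longleftrightarrow> e_spaces"
  proof
    assume "\<exists>h. Sym_coarse_equivalence X \<E>X Y \<E>Y h"
    then obtain h where h: "Sym_coarse_equivalence X \<E>X Y \<E>Y h" by blast
    then have "h \<in> X \<rightarrow> Y" unfolding Sym_coarse_equivalence_def by blast
    from ad[OF this] de[OF this] h show e_spaces unfolding e_spaces_def by blast
  next
    assume e_spaces
    then obtain X' Y' f' where as: "asymorphism_of_large_subspaces X \<E>X Y \<E>Y X' Y' f'"
      unfolding e_spaces_def by blast
    obtain h where h: "h \<in> X \<rightarrow> Y" "bornologous \<E>X \<E>Y h" "\<forall>x\<in>X'. f' x = h x"
      by (rule bornologous_extension[OF assms(1,2) as])
    \<comment> \<open>The extension satisfies the analogue of (e) for \<open>h\<close>, hence is an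
      equivalence by way of (d).\<close>
    from ad[OF h(1)] de[OF h(1)] as h(2,3)
    show "\<exists>h. Sym_coarse_equivalence X \<E>X Y \<E>Y h" by blast
  qed
  moreover have "a \<longleftrightarrow> d" unfolding a_def d_def by (rule ad[OF assms(3)])
  moreover have "d \<longleftrightarrow> e" unfolding d_def e_def by (rule de[OF assms(3)])
  ultimately show ?thesis using bd cd by blast
qed

end
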